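(* Let $0\le m\le n$ be integers with $n\ge 1$, and let $\lambda_0,\ldots,\lambda_m\in\mathbb{C}$ be such that all the zeros of $\phi(z)=\sum_{i=0}^m\binom{n}{i}\lambda_i z^i$ lie in the half plane $|z|\le |z-\frac n2|$. Let $N$ be the associated operator on $\mathcal{P}_n$. If $P\in\mathcal{P}_n$ is a self-inversive polynomial, then $$|N[P](z)|\le \frac12\Big(|N[\psi_n](z)|+|\lambda_0|\Big)M\quad\text{for } |z|\ge 1,$$ where $M=\max_{|z|=1}|P(z)|$ and $\psi_n(z)=z^n$. For $P(z)=z^n+1$, equality is attained in this inequality at some $z$ with $|z|\ge 1$.
   Context: $\mathcal{P}_n$ denotes the class of all polynomials with complex coefficients of degree at most $n$. For given $\lambda_0,\ldots,\lambda_m\in\mathbb{C}$ the operator $N:\mathcal{P}_n\to\mathcal{P}_n$ is defined by $$N[P](z)=\sum_{i=0}^{m}\lambda_i\left(\frac{nz}{2}\right)^i\frac{P^{(i)}(z)}{i!},$$ where $P^{(i)}$ is the $i$-th derivative of $P$. For $P\in\mathcal{P}_n$ let $P^*(z)=z^n\overline{P(1/\overline{z})}$ (understood as a polynomial in $\mathcal{P}_n$). A polynomial $P\in\mathcal{P}_n$ is called self-inversive if $P(z)=P^*(z)$. *)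

theory Defs
  imports "HOL-Analysis.Analysis" "HOL-Computational_Algebra.Polynomial"
begin

definition polys_upto :: "nat \<Rightarrow> complex poly set" where
  "polys_upto n = {P. degree P \<le> n}"

definition N_op :: "nat \<Rightarrow> nat \<Rightarrow> (nat \<Rightarrow> complex) \<Rightarrow> complex poly \<Rightarrow> complex poly" where
  "N_op n m lam P =
     (\<Sum>i\<le>m. smult (lam i) ([:0, of_nat n / 2:] ^ i * smult (1 / fact i) ((pderiv ^^ i) P)))"

definition phi :: "nat \<Rightarrow> nat \<Rightarrow> (nat \<Rightarrow> complex) \<Rightarrow> complex poly" where
  "phi n m lam = (\<Sum>i\<le>m. monom (of_nat (n choose i) * lam i) i)"

text \<open>The formula for $P^*$ makes sense only for $z \neq 0$; it determines a unique polynomial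
  of degree at most $n$ when $P$ has degree at most $n$ (see \<open>star_eq\<close> below), and the
  definition is only meant for such $P$.\<close>

definition star :: "nat \<Rightarrow> complex poly \<Rightarrow> complex poly" where
  "star n P = (THE Q. Q \<in> polys_upto n \<and>
     (\<forall>z. z \<noteq> 0 \<longrightarrow> poly Q z = z ^ n * cnj (poly P (1 / cnj z))))"

definition self_inversive :: "nat \<Rightarrow> complex poly \<Rightarrow> bool" where
  "self_inversive n P \<longleftrightarrow> P \<in> polys_upto n \<and> P = star n P"

text \<open>The supremum is a maximum, see \<open>max_unit_circle_attained\<close>.\<close>

definition max_unit_circle :: "complex poly \<Rightarrow> real" where
  "max_unit_circle P = (SUP z\<in>sphere 0 1. cmod (poly P z))"

lemma poly_N_op:
  "poly (N_op n m lam P) z =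
     (\<Sum>i\<le>m. lam i * (of_nat n * z / 2) ^ i * (poly ((pderiv ^^ i) P) z / fact i))"
  by (simp add: N_op_def poly_sum poly_power mult.commute mult.left_commute)

lemma poly_phi: "poly (phi n m lam) z = (\<Sum>i\<le>m. of_nat (n choose i) * lam i * z ^ i)"
  by (simp add: phi_def poly_sum poly_monom)

lemma star_eq:
  assumes "P \<in> polys_upto n"
  shows "star n P = (\<Sum>k\<le>n. monom (cnj (coeff P (n - k))) k)" (is "_ = ?Q")
  unfolding star_def
proof (rule the_equality)
  have d: "degree P \<le> n" using assms by (simp add: polys_upto_def)
  have "degree ?Q \<le> n"
    by (intro degree_sum_le) (auto intro: order_trans[OF degree_monom_le])
  moreover have "poly ?Q z = z ^ n * cnj (poly P (1 / cnj z))" if z: "z \<noteq> 0" for z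
  proof -
    have "poly P (1 / cnj z) = (\<Sum>k\<le>n. coeff P k * (1 / cnj z) ^ k)"
      unfolding poly_altdef
      by (rule sum.mono_neutral_left) (use d in \<open>auto simp: coeff_eq_0\<close>)
    then have "z ^ n * cnj (poly P (1 / cnj z)) = (\<Sum>k\<le>n. cnj (coeff P k) * z ^ (n - k))"
      using z by (auto simp: sum_distrib_left power_diff field_simps intro!: sum.cong)
    also have "\<dots> = (\<Sum>k\<le>n. cnj (coeff P (n - k)) * z ^ k)"
      by (rule sum.reindex_bij_witness[of _ "\<lambda>k. n - k" "\<lambda>k. n - k"]) auto
    finally show ?thesis by (simp add: poly_sum poly_monom)
  qed
  ultimately show Q: "?Q \<in> polys_upto n \<and>
      (\<forall>z. z \<noteq> 0 \<longrightarrow> poly ?Q z = z ^ n * cnj (poly P (1 / cnj z)))"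
    by (simp add: polys_upto_def)
  fix R assume R: "R \<in> polys_upto n \<and>
      (\<forall>z. z \<noteq> 0 \<longrightarrow> poly R z = z ^ n * cnj (poly P (1 / cnj z)))"
  show "R = ?Q"
  proof (rule ccontr)
    assume "R \<noteq> ?Q"
    then have "finite {z. poly (R - ?Q) z = 0}" by (intro poly_roots_finite) simp
    moreover have "- {0} \<subseteq> {z. poly (R - ?Q) z = 0}" using Q R by auto
    ultimately have "finite (- {0 :: complex})" by (rule rev_finite_subset)
    then show False by (simp add: infinite_UNIV_char_0)
  qed
qed

lemma max_unit_circle_attained:
  "\<exists>z. cmod z = 1 \<and> max_unit_circle P = cmod (poly P z) \<and>
     (\<forall>w. cmod w = 1 \<longrightarrow> cmod (poly P w) \<le> max_unit_circle P)"
proof -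
  obtain z where z: "z \<in> sphere 0 1" "\<forall>w\<in>sphere 0 1. cmod (poly P w) \<le> cmod (poly P z)"
    using continuous_attains_sup[of "sphere 0 1" "\<lambda>w. cmod (poly P w)"]
    by (force intro!: continuous_intros)
  then have "max_unit_circle P = cmod (poly P z)"
    unfolding max_unit_circle_def by (intro cSup_eq_maximum) auto
  then show ?thesis using z by auto
qed

end

theory Submission
  imports Defs
    "HOL-Computational_Algebra.Fundamental_Theorem_Algebra"
    "HOL-Complex_Analysis.Conformal_Mappings"
begin

text \<open>
The condition on $\phi$ ensures that $N$ maps every polynomial $Q$ of degree $n$ with all zeros in
the open unit disc to one with all zeros there: $N[Q](z)$ is nonzero whenever
$|z| \ge 1$ (\<open>N_op_nonzero_outside_disc\<close>). Indeed $Q \mapsto N[Q](z)$ is a linear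
functional, and by the theorem of Grace, Walsh and Szego (\<open>grace_walsh_szego\<close>) it is enough to
look at $Q = (x-a)^n$ with $|a| < 1$. There $N[Q](z) = (z-a)^n \phi(u)$ with an explicit point $u$
that lies outside the half plane containing the zeros of $\phi$. The theorem of Grace, Walsh and
Szego is proved by induction on the degree through Laguerre's theorem on polar derivatives, which
rests on the convexity of the image of a ball under inversion at a point outside it.

Such a statement on zeros yields inequalities. If $G$ has no zeros in the closed unit disc, then
$|G^*| \le |G|$ there by the maximum modulus principle, so the polynomials $sG - G^*$ with
$|s| < 1$ have degree $n$ and all zeros in the open disc. Since $sN[G](z) - N[G^*](z)$ never
vanishes, $|N[G](z)| \le |N[G^*](z)|$ (\<open>N_op_le_N_op_star\<close>). For a self-inversive $P$ this is
applied to $G = P - s$ with $|s| > M$, for which $G^* = P - \overline{s} z^n$. A suitable choice of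
the argument of $s$ and the limit $|s| \to M$ give the inequality.

Equality for $z^n + 1$ holds at a point of the unit circle where $N[z^n]$ and
$N[1] = \lambda_0$ point in the same direction.
\<close>

section \<open>Means of zeros in a ball\<close>

lemma norm_sq_convex_combination:
  fixes x y :: "'a::real_inner"
  assumes "s + t = 1"
  shows "(norm (s *\<^sub>R x + t *\<^sub>R y))\<^sup>2 =
         s * (norm x)\<^sup>2 + t * (norm y)\<^sup>2 - s * t * (norm (x - y))\<^sup>2"
proof -
  have s: "s = 1 - t" using assms by simp
  show ?thesis
    unfolding s by (simp add: power2_norm_eq_inner inner_add inner_diff inner_commute algebra_simps)
qed

text \<open>The set is the image under $a \mapsto 1/(v-a)$ of the ball of radius $r$ about $0$. Squaring both
sides describes it by a quadratic function of $w$ with leading term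
$(|v|^2 - r^2)|w|^2$, and this is convex exactly because $v$ lies outside the ball.\<close>

lemma convex_inverted_ball:
  fixes v :: complex
  assumes "0 \<le> r" "r \<le> cmod v"
  shows "convex {w. cmod (v * w - 1) < r * cmod w}"
proof (rule convexI)
  fix x y :: complex and s t :: real
  assume x: "x \<in> {w. cmod (v * w - 1) < r * cmod w}"
    and y: "y \<in> {w. cmod (v * w - 1) < r * cmod w}"
    and st: "0 \<le> s" "0 \<le> t" "s + t = 1"
  define f where "f = (\<lambda>w. (cmod (v * w - 1))\<^sup>2 - r\<^sup>2 * (cmod w)\<^sup>2)"
  have mem: "cmod (v * w - 1) < r * cmod w \<longleftrightarrow> f w < 0" for w
    using assms(1) unfolding f_def
    by (metis diff_less_0_iff_less mult_nonneg_nonneg norm_ge_zero power2_less_imp_less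
        power_mult_distrib power_strict_mono zero_less_numeral)
  have "v * (s *\<^sub>R x + t *\<^sub>R y) - 1 = s *\<^sub>R (v * x - 1) + t *\<^sub>R (v * y - 1)"
  proof -
    have "s *\<^sub>R (1::complex) + t *\<^sub>R 1 = 1" using st(3) by (metis scaleR_add_left scaleR_one)
    then show ?thesis by (simp add: algebra_simps)
  qed
  moreover have "cmod ((v * x - 1) - (v * y - 1)) = cmod v * cmod (x - y)"
    by (simp add: norm_mult[symmetric] algebra_simps)
  ultimately have "(cmod (v * (s *\<^sub>R x + t *\<^sub>R y) - 1))\<^sup>2 =
      s * (cmod (v * x - 1))\<^sup>2 + t * (cmod (v * y - 1))\<^sup>2 - s * t * (cmod v * cmod (x - y))\<^sup>2"
    using norm_sq_convex_combination[OF st(3), of "v * x - 1" "v * y - 1"] by simp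
  then have "f (s *\<^sub>R x + t *\<^sub>R y) =
      s * f x + t * f y - s * t * ((cmod v)\<^sup>2 - r\<^sup>2) * (cmod (x - y))\<^sup>2"
    unfolding f_def by (simp add: norm_sq_convex_combination[OF st(3)] power_mult_distrib algebra_simps)
  moreover have "0 \<le> s * t * ((cmod v)\<^sup>2 - r\<^sup>2) * (cmod (x - y))\<^sup>2"
    using st assms by (intro mult_nonneg_nonneg) (auto intro: power_mono)
  moreover have "s * f x + t * f y < 0"
    using x y st mem
    by (smt (verit, ccfv_SIG) mem_Collect_eq mult_less_0_iff mult_nonneg_nonpos)
  ultimately show "s *\<^sub>R x + t *\<^sub>R y \<in> {w. cmod (v * w - 1) < r * cmod w}"
    by (simp add: mem)
qed

text \<open>This transports the convexity of the inverted ball back to the ball itself. It is what lets a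
weighted mean of the terms $1/(y-a_j)$ in a logarithmic derivative be replaced by a single such
term, so that a polynomial with all zeros in the ball can be treated like a power of $x-a$.\<close>

lemma harmonic_mean_in_ball:
  fixes y b a0 a1 :: complex
  assumes a: "a0 \<in> ball b r" "a1 \<in> ball b r" and y: "y \<notin> ball b r"
    and st: "0 \<le> s" "0 \<le> t" "s + t = 1"
  obtains a where "a \<in> ball b r"
    "of_real s / (y - a0) + of_real t / (y - a1) = 1 / (y - a)"
proof -
  define W where "W = {w. cmod ((y - b) * w - 1) < r * cmod w}"
  have r: "0 \<le> r" "r \<le> cmod (y - b)"
    using a y by (auto simp: dist_norm norm_minus_commute intro: order.trans[OF norm_ge_zero less_imp_le])
  have ball: "c \<in> ball b r \<longleftrightarrow> w \<in> W" if "w \<noteq> 0" "c = y - 1 / w" for c w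
  proof -
    have "(y - b) * w - 1 = (c - b) * w" using that by (simp add: field_simps)
    then have "cmod ((y - b) * w - 1) = dist b c * cmod w"
      by (simp add: norm_mult dist_norm norm_minus_commute)
    then show ?thesis using that(1) by (simp add: W_def)
  qed
  have W: "1 / (y - c) \<in> W" if "c \<in> ball b r" for c
  proof -
    have "y - c \<noteq> 0" using that y by auto
    then show ?thesis using ball[of "1 / (y - c)" c] that by simp
  qed
  define w where "w = s *\<^sub>R (1 / (y - a0)) + t *\<^sub>R (1 / (y - a1))"
  have "w \<in> W"
    unfolding w_def using convex_inverted_ball[OF r] W a st unfolding W_def[symmetric]
    by (intro convexD) auto
  moreover from this have "w \<noteq> 0" by (auto simp: W_def)
  ultimately show ?thesis
    using ball[of w "y - 1 / w"] by (intro that[of "y - 1 / w"]) (auto simp: w_def scaleR_conv_of_real)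
qed

lemma poly_split_root:
  fixes Q :: "complex poly"
  assumes "degree Q = Suc k"
  obtains a R where "poly Q a = 0" "Q = [:- a, 1:] * R" "degree R = k"
proof -
  have "\<not> (\<exists>a l. a \<noteq> 0 \<and> l = 0 \<and> Q = pCons a l)" using assms by auto
  then obtain a where a: "poly Q a = 0" using fundamental_theorem_of_algebra_alt by blast
  then obtain R where R: "Q = [:- a, 1:] * R" by (auto simp: poly_eq_0_iff_dvd)
  then have "R \<noteq> 0" using assms by auto
  then have "degree Q = Suc (degree R)" unfolding R by (subst degree_mult_eq) auto
  then show ?thesis using that a R assms by auto
qed

lemma poly_pderiv_linear_mult:
  "poly (pderiv ([:- a, 1:] * R)) y = poly R y + (y - a) * poly (pderiv R) y"
  for a y :: "'a::idom"
  by (simp add: pderiv_mult pderiv_pCons del: mult_pCons_left)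

text \<open>Seen from a point outside a ball that contains all its zeros, $Q$ has the logarithmic derivative
of $(x-a)^{\deg Q}$ for some $a$ in the ball: $Q'(y)/Q(y)$ is the sum of the $1/(y-a_j)$ over the
zeros $a_j$. The induction splits off one zero and merges it with the point obtained for the
cofactor.\<close>

lemma log_derivative_outside_ball:
  fixes Q :: "complex poly"
  assumes "degree Q = Suc k" "\<And>x. poly Q x = 0 \<Longrightarrow> x \<in> ball b r" "y \<notin> ball b r"
  shows "\<exists>a \<in> ball b r. (y - a) * poly (pderiv Q) y = of_nat (Suc k) * poly Q y"
  using assms
proof (induction k arbitrary: Q)
  case (0 Q)
  then obtain a R where aR: "poly Q a = 0" "Q = [:- a, 1:] * R" "degree R = 0"
    using poly_split_root by blast
  then have "pderiv R = 0" by (simp add: pderiv_eq_0_iff)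
  then have "(y - a) * poly (pderiv Q) y = poly Q y"
    using aR by (simp add: poly_pderiv_linear_mult del: mult_pCons_left)
  then show ?case using 0 aR by auto
next
  case (Suc k Q)
  then obtain a0 R where aR: "poly Q a0 = 0" "Q = [:- a0, 1:] * R" "degree R = Suc k"
    using poly_split_root by blast
  have "\<And>x. poly R x = 0 \<Longrightarrow> x \<in> ball b r" using Suc.prems(2) aR(2) by simp
  then obtain a1 where a1: "a1 \<in> ball b r"
      "(y - a1) * poly (pderiv R) y = of_nat (Suc k) * poly R y"
    using Suc.IH[OF aR(3)] Suc.prems(3) by blast
  have a0: "a0 \<in> ball b r" using Suc.prems(2) aR(1) by simp
  \<comment> \<open>the split-off zero has weight 1/n, the mean of the other zeros has weight (n - 1)/n\<close>
  define n where "n = real (Suc (Suc k))"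
  have n: "n > 0" "n = 1 + real (Suc k)" by (simp_all add: n_def)
  obtain a where a: "a \<in> ball b r"
      "of_real (1 / n) / (y - a0) + of_real (real (Suc k) / n) / (y - a1) = 1 / (y - a)"
    using harmonic_mean_in_ball[OF a0 a1(1) Suc.prems(3), of "1 / n" "real (Suc k) / n"] n
    by (auto simp: add_divide_distrib[symmetric])
  have ne: "y - a0 \<noteq> 0" "y - a1 \<noteq> 0" "y - a \<noteq> 0" "complex_of_real n \<noteq> 0"
    using a0 a1 a n Suc.prems(3) by auto
  have "poly (pderiv R) y = of_nat (Suc k) * poly R y / (y - a1)"
    using a1(2) ne by (simp add: field_simps)
  moreover have "poly (pderiv Q) y = poly R y + (y - a0) * poly (pderiv R) y"
    unfolding aR(2) by (rule poly_pderiv_linear_mult)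
  moreover have "poly Q y = (y - a0) * poly R y" by (simp add: aR(2) algebra_simps)
  ultimately have "poly (pderiv Q) y =
      n * poly Q y * (of_real (1 / n) / (y - a0) + of_real (real (Suc k) / n) / (y - a1))"
    using ne by (simp add: divide_simps) (simp add: algebra_simps)
  also have "\<dots> = n * poly Q y / (y - a)" unfolding a(2) by simp
  finally have "(y - a) * poly (pderiv Q) y = of_nat (Suc (Suc k)) * poly Q y"
    using ne(3) by (simp add: n_def)
  then show ?case using a(1) by blast
qed

text \<open>The analogue of the preceding lemma for $y = \infty$: by Vieta the quotient of the two leading
coefficients is minus the sum of the zeros, and the arithmetic mean of the zeros lies in the ball.
It controls the degree of a polar derivative.\<close>

lemma second_coeff_roots_in_ball:
  fixes Q :: "complex poly"
  assumes "degree Q = Suc k" "\<And>x. poly Q x = 0 \<Longrightarrow> x \<in> ball b r"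
  shows "\<exists>a \<in> ball b r. coeff Q k = - of_nat (Suc k) * a * coeff Q (Suc k)"
  using assms
proof (induction k arbitrary: Q)
  case (0 Q)
  then obtain a R where aR: "poly Q a = 0" "Q = [:- a, 1:] * R" "degree R = 0"
    using poly_split_root by blast
  then have "coeff Q 0 = - of_nat (Suc 0) * a * coeff Q (Suc 0)"
    by (simp add: aR(2) coeff_eq_0)
  then show ?case using 0 aR by blast
next
  case (Suc k Q)
  then obtain a0 R where aR: "poly Q a0 = 0" "Q = [:- a0, 1:] * R" "degree R = Suc k"
    using poly_split_root by blast
  have "\<And>x. poly R x = 0 \<Longrightarrow> x \<in> ball b r" using Suc.prems(2) aR(2) by simp
  then obtain a1 where a1: "a1 \<in> ball b r"
      "coeff R k = - of_nat (Suc k) * a1 * coeff R (Suc k)"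
    using Suc.IH[OF aR(3)] by blast
  have a0: "a0 \<in> ball b r" using Suc.prems(2) aR(1) by simp
  define n where "n = real (Suc (Suc k))"
  have n: "n > 0" "n = 1 + real (Suc k)" by (simp_all add: n_def)
  define a where "a = (1 / n) *\<^sub>R a0 + (real (Suc k) / n) *\<^sub>R a1"
  have "a \<in> ball b r"
    unfolding a_def using a0 a1(1) n
    by (intro convexD[OF convex_ball]) (auto simp: add_divide_distrib[symmetric])
  moreover have "complex_of_real n * a = a0 + of_nat (Suc k) * a1"
    unfolding a_def using n(1) by (simp add: scaleR_conv_of_real distrib_left)
  moreover have "coeff Q (Suc k) = - (a0 + of_nat (Suc k) * a1) * coeff R (Suc k)"
    using a1(2) by (simp add: aR(2) algebra_simps)
  moreover have "coeff Q (Suc (Suc k)) = coeff R (Suc k)"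
    using aR(3) by (simp add: aR(2) coeff_eq_0)
  ultimately have "coeff Q (Suc k) = - (complex_of_real n * a) * coeff Q (Suc (Suc k))" by metis
  then show ?case using \<open>a \<in> ball b r\<close> by (intro bexI[of _ a]) (simp_all add: n_def algebra_simps)
qed

section \<open>Polar derivatives\<close>

text \<open>The polar derivative of a polynomial of degree at most $n$ with respect to the pole $\zeta$. The
number $n$ is a parameter, since it can exceed the degree; for $n \ge 1$ the
value has degree below $n$.\<close>

definition polar_derivative :: "nat \<Rightarrow> complex \<Rightarrow> complex poly \<Rightarrow> complex poly" where
  "polar_derivative n \<zeta> Q = smult (of_nat n) Q + [:\<zeta>, - 1:] * pderiv Q"

lemma coeff_polar_derivative:
  "coeff (polar_derivative n \<zeta> Q) i =
     (of_nat n - of_nat i) * coeff Q i + \<zeta> * of_nat (Suc i) * coeff Q (Suc i)"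
  by (cases i) (simp_all add: polar_derivative_def coeff_pderiv algebra_simps)

lemma poly_polar_derivative:
  "poly (polar_derivative n \<zeta> Q) y = of_nat n * poly Q y + (\<zeta> - y) * poly (pderiv Q) y"
  by (simp add: polar_derivative_def algebra_simps)

lemma polar_derivative_linear_power:
  "polar_derivative (Suc k) \<zeta> ([:- a, 1:] ^ Suc k) = smult (of_nat (Suc k) * (\<zeta> - a)) ([:- a, 1:] ^ k)"
proof -
  have d: "pderiv [:- a, 1:] = 1" by (simp add: pderiv_pCons)
  have "polar_derivative (Suc k) \<zeta> ([:- a, 1:] ^ Suc k) =
      smult (of_nat (Suc k)) (([:- a, 1:] + [:\<zeta>, - 1:]) * [:- a, 1:] ^ k)"
    unfolding polar_derivative_def pderiv_power_Suc d mult_1_right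
    by (simp only: power_Suc distrib_right smult_add_right mult_smult_right)
  also have "[:- a, 1:] + [:\<zeta>, - 1:] = [:\<zeta> - a:]" by simp
  finally show ?thesis by simp
qed

text \<open>Laguerre's theorem. At a zero $y$ outside the ball, replacing $Q$ by $(x-a)^n$ turns the polar
derivative into a nonzero multiple of $\zeta - a$, which vanishes only if $\zeta = a$ is in the
ball. The same argument at $y = \infty$ shows that the degree drops by exactly one; without this
exactness the theorem could not be iterated.\<close>

lemma laguerre_polar_derivative:
  assumes "degree Q = Suc k" "\<And>x. poly Q x = 0 \<Longrightarrow> x \<in> ball b r" "\<zeta> \<notin> ball b r"
  shows "degree (polar_derivative (Suc k) \<zeta> Q) = k"
    and "poly (polar_derivative (Suc k) \<zeta> Q) y = 0 \<Longrightarrow> y \<in> ball b r"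
proof -
  obtain a where a: "a \<in> ball b r" "coeff Q k = - of_nat (Suc k) * a * coeff Q (Suc k)"
    using second_coeff_roots_in_ball[OF assms(1,2)] by blast
  have "coeff (polar_derivative (Suc k) \<zeta> Q) k = of_nat (Suc k) * (\<zeta> - a) * coeff Q (Suc k)"
    unfolding coeff_polar_derivative a(2) by (simp add: algebra_simps)
  moreover have "coeff Q (Suc k) \<noteq> 0" using assms(1) by (metis leading_coeff_0_iff degree_0 nat.distinct(1))
  moreover have "\<zeta> \<noteq> a" using a(1) assms(3) by auto
  ultimately have "coeff (polar_derivative (Suc k) \<zeta> Q) k \<noteq> 0"
    by (simp del: of_nat_Suc)
  moreover have "coeff (polar_derivative (Suc k) \<zeta> Q) i = 0" if "k < i" for i
    using that assms(1) by (cases "i = Suc k") (simp_all add: coeff_polar_derivative coeff_eq_0)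
  ultimately show "degree (polar_derivative (Suc k) \<zeta> Q) = k"
    by (metis le_degree degree_le antisym)
next
  assume 0: "poly (polar_derivative (Suc k) \<zeta> Q) y = 0"
  show "y \<in> ball b r"
  proof (rule ccontr)
    assume y: "y \<notin> ball b r"
    obtain a where a: "a \<in> ball b r" "(y - a) * poly (pderiv Q) y = of_nat (Suc k) * poly Q y"
      using log_derivative_outside_ball[OF assms(1,2) y] by blast
    have "(\<zeta> - a) * poly (pderiv Q) y = 0"
      using 0 unfolding poly_polar_derivative a(2)[symmetric] by (simp add: algebra_simps)
    moreover have "\<zeta> \<noteq> a" using a(1) assms(3) by auto
    moreover have "poly Q y \<noteq> 0" using assms(2) y by blast
    ultimately show False using a(2) by (simp del: of_nat_Suc)
  qed
qed

text \<open>The case $\zeta = \infty$ of Laguerre's theorem.\<close>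

lemma gauss_lucas_ball:
  fixes Q :: "complex poly"
  assumes "degree Q = Suc k" "\<And>x. poly Q x = 0 \<Longrightarrow> x \<in> ball b r"
    and "poly (pderiv Q) y = 0"
  shows "y \<in> ball b r"
proof (rule ccontr)
  assume y: "y \<notin> ball b r"
  have "of_nat (Suc k) * poly Q y = 0"
    using log_derivative_outside_ball[OF assms(1,2) y] assms(3) by auto
  then show False using assms(2) y by (simp del: of_nat_Suc)
qed

text \<open>For a functional $L$ on polynomials of degree at most $n = k+1$ with $L((x-\zeta)^n) = 0$ there is a
functional $L'$ on polynomials of degree at most $k$ whose composition with the polar derivative at
$\zeta$ is $L$. Matching the coefficients of $Q$ of index $0,\dots,k$ is a triangular system for the
coefficients $d_i$ of $L'$. The remaining condition, for the index $n$, is tested on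
$Q = (x-\zeta)^n$: both sides vanish there and the leading coefficient is $1$.\<close>

lemma functional_factors_through_polar_derivative:
  fixes c :: "nat \<Rightarrow> complex"
  assumes "(\<Sum>i\<le>Suc k. c i * coeff ([:- \<zeta>, 1:] ^ Suc k) i) = 0"
  obtains d where "\<And>Q. (\<Sum>i\<le>Suc k. c i * coeff Q i) =
      (\<Sum>i\<le>k. d i * coeff (polar_derivative (Suc k) \<zeta> Q) i)"
proof -
  \<comment> \<open>the solution of the triangular system by forward substitution\<close>
  define d where "d = rec_nat (c 0 / of_nat (Suc k))
      (\<lambda>i x. (c (Suc i) - \<zeta> * of_nat (Suc i) * x) / (of_nat (Suc k) - of_nat (Suc i)))"
  have d0: "of_nat (Suc k) * d 0 = c 0" by (simp add: d_def del: of_nat_Suc)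
  have dS: "(of_nat (Suc k) - of_nat (Suc i)) * d (Suc i) = c (Suc i) - \<zeta> * of_nat (Suc i) * d i"
    if "i < k" for i
    using that by (simp add: d_def)
  have partial: "(\<Sum>i\<le>j. d i * coeff (polar_derivative (Suc k) \<zeta> Q) i) =
      (\<Sum>i\<le>j. c i * coeff Q i) + \<zeta> * of_nat (Suc j) * d j * coeff Q (Suc j)" if "j \<le> k" for j Q
    using that
  proof (induction j)
    case 0
    then show ?case by (simp add: coeff_polar_derivative d0[symmetric] algebra_simps)
  next
    case (Suc j)
    have c: "c (Suc j) = (of_nat (Suc k) - of_nat (Suc j)) * d (Suc j) + \<zeta> * of_nat (Suc j) * d j"
      using dS[of j] Suc.prems by simp
    have "d (Suc j) * coeff (polar_derivative (Suc k) \<zeta> Q) (Suc j) =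
        c (Suc j) * coeff Q (Suc j) - \<zeta> * of_nat (Suc j) * d j * coeff Q (Suc j)
          + \<zeta> * of_nat (Suc (Suc j)) * d (Suc j) * coeff Q (Suc (Suc j))"
      unfolding coeff_polar_derivative c by (simp only: algebra_simps)
    then show ?case using Suc by simp
  qed
  define e where "e = c (Suc k) - \<zeta> * of_nat (Suc k) * d k"
  have diff: "(\<Sum>i\<le>Suc k. c i * coeff Q i) =
      (\<Sum>i\<le>k. d i * coeff (polar_derivative (Suc k) \<zeta> Q) i) + e * coeff Q (Suc k)" for Q
    using partial[of k Q] by (simp add: e_def algebra_simps)
  have "polar_derivative (Suc k) \<zeta> ([:- \<zeta>, 1:] ^ Suc k) = 0"
    by (simp only: polar_derivative_linear_power) simp
  then have "e = 0"
    using diff[of "[:- \<zeta>, 1:] ^ Suc k"] assms by (simp add: coeff_linear_power del: power_Suc sum.atMost_Suc)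
  then show ?thesis using diff that by simp
qed

section \<open>The theorem of Grace, Walsh and Szego\<close>

text \<open>Let $L$ be the linear functional with coefficients $c_i$. As a function of $a$, the value
$L((x-a)^n)$ is a polynomial of degree at most $n$, in which $a^n$ has the coefficient $\pm c_0$. If $c_0 \ne 0$, it has a zero
$\zeta$, which lies outside the ball, and $L$ factors through the polar derivative at $\zeta$. If
$c_0 = 0$, the zero has moved to $\infty$ and $L$ factors through the ordinary derivative. In both
cases the derivative maps $(x-a)^n$ to a nonzero multiple of $(x-a)^{n-1}$ and keeps the zeros in
the ball, so that induction on $n$ applies.\<close>

theorem grace_walsh_szego:
  fixes c :: "nat \<Rightarrow> complex"
  assumes "0 < r"
    and "degree Q = n" "\<And>x. poly Q x = 0 \<Longrightarrow> x \<in> ball b r"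
    and "\<And>a. a \<in> ball b r \<Longrightarrow> (\<Sum>i\<le>n. c i * coeff ([:- a, 1:] ^ n) i) \<noteq> 0"
  shows "(\<Sum>i\<le>n. c i * coeff Q i) \<noteq> 0"
  using assms(2-)
proof (induction n arbitrary: c Q)
  case 0
  \<comment> \<open>the zero polynomial is excluded because it would vanish outside the ball as well\<close>
  have "b + of_real r \<notin> ball b r" using assms(1) by (simp add: dist_norm)
  then have "Q \<noteq> 0" using 0(2)[of "b + of_real r"] by auto
  then have "coeff Q 0 \<noteq> 0" using 0(1) by (metis leading_coeff_0_iff)
  moreover have "c 0 \<noteq> 0" using 0(3)[of b] assms(1) by simp
  ultimately show ?case by simp
next
  case (Suc k)
  show ?case
  proof (cases "c 0 = 0")
    case True
    define d where "d i = c (Suc i) / of_nat (Suc i)" for i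
    have L: "(\<Sum>i\<le>Suc k. c i * coeff R i) = (\<Sum>i\<le>k. d i * coeff (pderiv R) i)" for R
      using True by (simp add: sum.atMost_Suc_shift d_def coeff_pderiv del: of_nat_Suc sum.atMost_Suc)
    have "(\<Sum>i\<le>k. d i * coeff ([:- a, 1:] ^ k) i) \<noteq> 0" if "a \<in> ball b r" for a
    proof -
      have "pderiv ([:- a, 1:] ^ Suc k) = smult (of_nat (Suc k)) ([:- a, 1:] ^ k)"
        unfolding pderiv_power_Suc by (simp add: pderiv_pCons)
      then have "(\<Sum>i\<le>Suc k. c i * coeff ([:- a, 1:] ^ Suc k) i) =
          of_nat (Suc k) * (\<Sum>i\<le>k. d i * coeff ([:- a, 1:] ^ k) i)"
        by (simp only: L) (simp add: sum_distrib_left mult_ac)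
      then show ?thesis using Suc.prems(3)[OF that] by auto
    qed
    moreover have "degree (pderiv Q) = k" using Suc.prems(1) by (simp add: degree_pderiv)
    ultimately show ?thesis
      unfolding L using gauss_lucas_ball[OF Suc.prems(1,2)] by (rule Suc.IH[rotated 2])
  next
    case False
    define p where "p = (\<Sum>i\<le>Suc k. monom (c i * of_nat (Suc k choose i) * (- 1) ^ (Suc k - i)) (Suc k - i))"
    have p: "poly p a = (\<Sum>i\<le>Suc k. c i * coeff ([:- a, 1:] ^ Suc k) i)" for a
      unfolding p_def poly_sum
    proof (intro sum.cong refl)
      fix i assume "i \<in> {..Suc k}"
      then have "coeff ([:- a, 1:] ^ Suc k) i = of_nat (Suc k choose i) * (- a) ^ (Suc k - i)"
        by (subst coeff_linear_poly_power) auto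
      moreover have "(- a) ^ (Suc k - i) = (- 1) ^ (Suc k - i) * a ^ (Suc k - i)"
        by (metis mult_minus1 power_mult_distrib)
      ultimately show "poly (monom (c i * of_nat (Suc k choose i) * (- 1) ^ (Suc k - i)) (Suc k - i)) a =
          c i * coeff ([:- a, 1:] ^ Suc k) i"
        by (simp add: poly_monom)
    qed
    have "coeff p (Suc k) = (\<Sum>i\<le>Suc k. if i = 0 then c 0 * (- 1) ^ Suc k else 0)"
      unfolding p_def coeff_sum by (intro sum.cong) auto
    then have "coeff p (Suc k) \<noteq> 0" using False by (simp del: sum.atMost_Suc)
    then have "\<not> (\<exists>a l. a \<noteq> 0 \<and> l = 0 \<and> p = pCons a l)" by auto
    then obtain \<zeta> where \<zeta>: "poly p \<zeta> = 0" using fundamental_theorem_of_algebra_alt by blast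
    then have out: "\<zeta> \<notin> ball b r" using Suc.prems(3) p by metis
    obtain d where d: "\<And>R. (\<Sum>i\<le>Suc k. c i * coeff R i) =
        (\<Sum>i\<le>k. d i * coeff (polar_derivative (Suc k) \<zeta> R) i)"
      using functional_factors_through_polar_derivative \<zeta> p by metis
    have "(\<Sum>i\<le>k. d i * coeff ([:- a, 1:] ^ k) i) \<noteq> 0" if "a \<in> ball b r" for a
    proof -
      have "(\<Sum>i\<le>Suc k. c i * coeff ([:- a, 1:] ^ Suc k) i) =
          of_nat (Suc k) * (\<zeta> - a) * (\<Sum>i\<le>k. d i * coeff ([:- a, 1:] ^ k) i)"
        unfolding d polar_derivative_linear_power by (simp add: sum_distrib_left mult_ac)
      then show ?thesis using Suc.prems(3)[OF that] by auto
    qed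
    with laguerre_polar_derivative[OF Suc.prems(1,2) out] show ?thesis
      unfolding d by (rule Suc.IH)
  qed
qed

section \<open>The operator N and the location of zeros\<close>

lemma higher_pderiv_linear_power:
  fixes a :: "'a::{idom,semiring_char_0}"
  shows "(pderiv ^^ i) ([:- a, 1:] ^ n) = smult (of_nat (fact i * (n choose i))) ([:- a, 1:] ^ (n - i))"
proof (induction i)
  case (Suc i)
  have "Suc i * (n choose Suc i) = (n - i) * (n choose i)"
    by (metis binomial_absorb_comp binomial_absorption)
  then have "fact (Suc i) * (n choose Suc i) = fact i * (n choose i) * (n - i)"
    by (simp only: fact_Suc of_nat_id mult_ac)
  then have "of_nat (fact (Suc i) * (n choose Suc i)) = (of_nat (fact i * (n choose i)) * of_nat (n - i) :: 'a)"
    by (metis of_nat_mult)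
  then show ?case
    using Suc by (simp add: pderiv_smult pderiv_power pderiv_pCons del: of_nat_mult)
qed simp

text \<open>On powers of a linear polynomial the operator reduces to an evaluation of $\phi$; the binomial
coefficients in $\phi$ are those of the derivatives of $(x-a)^n$.\<close>

lemma N_op_linear_power:
  assumes "m \<le> n" "z \<noteq> a"
  shows "poly (N_op n m lam ([:- a, 1:] ^ n)) z =
         (z - a) ^ n * poly (phi n m lam) (of_nat n * z / (2 * (z - a)))"
  unfolding poly_N_op poly_phi sum_distrib_left
proof (rule sum.cong)
  fix i assume "i \<in> {..m}"
  then have "(z - a) ^ n = (z - a) ^ i * (z - a) ^ (n - i)"
    using assms(1) by (simp flip: power_add)
  then show "lam i * (of_nat n * z / 2) ^ i * (poly ((pderiv ^^ i) ([:- a, 1:] ^ n)) z / fact i) =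
      (z - a) ^ n * (of_nat (n choose i) * lam i * (of_nat n * z / (2 * (z - a))) ^ i)"
    using assms(2)
    by (simp add: higher_pderiv_linear_power poly_power power_divide power_mult_distrib
        del: right_diff_distrib_numeral)
qed simp

lemma poly_N_op_add: "poly (N_op n m lam (P + Q)) z = poly (N_op n m lam P) z + poly (N_op n m lam Q) z"
  by (simp add: poly_N_op higher_pderiv_add add_divide_distrib distrib_left sum.distrib)

lemma poly_N_op_smult: "poly (N_op n m lam (smult s P)) z = s * poly (N_op n m lam P) z"
  by (simp add: poly_N_op higher_pderiv_smult sum_distrib_left mult_ac)

lemma poly_N_op_diff: "poly (N_op n m lam (P - Q)) z = poly (N_op n m lam P) z - poly (N_op n m lam Q) z"
  using poly_N_op_add[of n m lam P "smult (- 1) Q" z] by (simp only: poly_N_op_smult) simp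

lemma poly_N_op_1: "poly (N_op n m lam 1) z = lam 0"
proof -
  have "poly (N_op n m lam 1) z = (\<Sum>i\<le>m. if i = 0 then lam 0 else 0)"
    unfolding poly_N_op
  proof (rule sum.cong)
    fix i
    show "lam i * (of_nat n * z / 2) ^ i * (poly ((pderiv ^^ i) 1) z / fact i) = (if i = 0 then lam 0 else 0)"
      by (cases i) (simp_all add: funpow_Suc_right del: funpow.simps)
  qed simp
  then show ?thesis by simp
qed

text \<open>Evaluation of $N[Q]$ at a fixed point as a linear functional of the coefficients, the form in which
the theorem of Grace, Walsh and Szego applies.\<close>

lemma poly_N_op_conv_coeffs:
  assumes "degree Q \<le> n"
  shows "poly (N_op n m lam Q) z = (\<Sum>i\<le>n. poly (N_op n m lam (monom 1 i)) z * coeff Q i)"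
proof -
  have "poly (N_op n m lam (\<Sum>i\<in>A. smult (s i) (R i))) z = (\<Sum>i\<in>A. poly (N_op n m lam (R i)) z * s i)"
    if "finite A" for A :: "nat set" and s R
    using that
    by (induction A rule: finite_induct)
      (simp_all add: poly_N_op_add poly_N_op_smult, simp add: poly_N_op)
  then have "poly (N_op n m lam (\<Sum>i\<le>n. smult (coeff Q i) (monom 1 i))) z =
      (\<Sum>i\<le>n. poly (N_op n m lam (monom 1 i)) z * coeff Q i)"
    by simp
  moreover have "(\<Sum>i\<le>n. smult (coeff Q i) (monom 1 i)) = Q"
    using poly_as_sum_of_monoms'[OF assms] by (simp add: smult_monom)
  ultimately show ?thesis by (simp only:)
qed

text \<open>By Grace, Walsh and Szego it suffices to consider $(x-a)^n$ with $|a| < 1$, where $N$ gives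
$(z-a)^n \phi(u)$ with $u = \frac{n}{2}\cdot\frac{z}{z-a}$. Since
$u - \frac n2 = \frac{n}{2}\cdot\frac{a}{z-a}$, the inequality $|a| < 1 \le |z|$ says that $u$ lies
strictly outside the half plane that contains the zeros of $\phi$.\<close>

lemma N_op_nonzero_outside_disc:
  assumes "m \<le> n" "n \<ge> 1"
    and phi: "\<And>z. poly (phi n m lam) z = 0 \<Longrightarrow> cmod z \<le> cmod (z - of_nat n / 2)"
    and "degree Q = n" "\<And>x. poly Q x = 0 \<Longrightarrow> x \<in> ball 0 1"
    and "1 \<le> cmod z"
  shows "poly (N_op n m lam Q) z \<noteq> 0"
proof -
  have "(\<Sum>i\<le>n. poly (N_op n m lam (monom 1 i)) z * coeff ([:- a, 1:] ^ n) i) \<noteq> 0"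
    if a: "a \<in> ball 0 1" for a
  proof -
    have az: "cmod a < cmod z" "z \<noteq> a" using a assms(6) by auto
    define u where "u = of_nat n * z / (2 * (z - a))"
    define q where "q = real n / (2 * cmod (z - a))"
    have q: "q > 0" using assms(2) az by (simp add: q_def)
    have "cmod u = q * cmod z" unfolding u_def q_def norm_mult norm_divide by simp
    moreover have "u - of_nat n / 2 = of_nat n * a / (2 * (z - a))"
      using az(2) by (simp add: u_def field_simps)
    then have "cmod (u - of_nat n / 2) = q * cmod a" unfolding q_def by (simp only: norm_mult norm_divide) simp
    ultimately have "poly (phi n m lam) u \<noteq> 0" using phi[of u] az(1) q by auto
    then have "poly (N_op n m lam ([:- a, 1:] ^ n)) z \<noteq> 0"
      using N_op_linear_power[OF assms(1) az(2)] az(2) by (simp add: u_def)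
    then show ?thesis
      by (subst (asm) poly_N_op_conv_coeffs) (simp_all add: degree_linear_power)
  qed
  from grace_walsh_szego[OF zero_less_one assms(4,5) this]
  have "(\<Sum>i\<le>n. poly (N_op n m lam (monom 1 i)) z * coeff Q i) \<noteq> 0" .
  then show ?thesis using assms(4) by (subst poly_N_op_conv_coeffs) auto
qed

section \<open>Reciprocal polynomials\<close>

text \<open>The maximum modulus principle for the quotient $g/h$.\<close>

lemma polynomial_domination_on_disc:
  fixes g h :: "complex poly"
  assumes circle: "\<And>x. cmod x = 1 \<Longrightarrow> cmod (poly g x) \<le> cmod (poly h x)"
    and nz: "\<And>x. cmod x \<le> 1 \<Longrightarrow> poly h x \<noteq> 0"
    and x: "cmod x \<le> 1"
  shows "cmod (poly g x) \<le> cmod (poly h x)"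
proof -
  have "cmod (poly g x / poly h x) \<le> 1"
  proof (rule maximum_modulus_frontier[of "\<lambda>x. poly g x / poly h x" "cball 0 1"])
    show "(\<lambda>x. poly g x / poly h x) holomorphic_on interior (cball 0 1)"
      using nz by (intro holomorphic_intros) auto
    show "continuous_on (closure (cball 0 1)) (\<lambda>x. poly g x / poly h x)"
      using nz by (intro continuous_intros) auto
    show "cmod (poly g y / poly h y) \<le> 1" if "y \<in> frontier (cball 0 1)" for y
      using that circle[of y] nz[of y] by (simp add: norm_divide)
  qed (use x in auto)
  then show ?thesis using nz[OF x] by (simp add: norm_divide)
qed

lemma coeff_star:
  assumes "degree P \<le> n"
  shows "coeff (star n P) k = (if k \<le> n then cnj (coeff P (n - k)) else 0)"
  using assms by (simp add: star_eq polys_upto_def coeff_sum)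

lemma degree_star: "degree P \<le> n \<Longrightarrow> degree (star n P) \<le> n"
  by (intro degree_le) (simp add: coeff_star)

lemma star_star: "degree P \<le> n \<Longrightarrow> star n (star n P) = P"
  by (intro poly_eqI) (simp add: coeff_star degree_star coeff_eq_0)

lemma poly_star:
  assumes "degree P \<le> n" "z \<noteq> 0"
  shows "poly (star n P) z = z ^ n * cnj (poly P (1 / cnj z))"
proof -
  have "poly P x = (\<Sum>k\<le>n. coeff P k * x ^ k)" for x
    unfolding poly_altdef
    by (rule sum.mono_neutral_left) (use assms in \<open>auto simp: coeff_eq_0\<close>)
  then have "z ^ n * cnj (poly P (1 / cnj z)) = (\<Sum>k\<le>n. cnj (coeff P k) * z ^ (n - k))"
    using assms(2) by (auto simp: sum_distrib_left power_diff field_simps intro!: sum.cong)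
  also have "\<dots> = (\<Sum>k\<le>n. cnj (coeff P (n - k)) * z ^ k)"
    by (rule sum.reindex_bij_witness[of _ "\<lambda>k. n - k" "\<lambda>k. n - k"]) auto
  finally show ?thesis
    using assms(1) by (simp add: star_eq polys_upto_def poly_sum poly_monom)
qed

text \<open>On the unit circle $G$ and $G^*$ have the same modulus.\<close>

lemma star_dominated_on_disc:
  assumes "degree G \<le> n" "\<And>x. cmod x \<le> 1 \<Longrightarrow> poly G x \<noteq> 0" "cmod x \<le> 1"
  shows "cmod (poly (star n G) x) \<le> cmod (poly G x)"
proof (rule polynomial_domination_on_disc[OF _ assms(2,3)])
  fix y assume y: "cmod y = 1"
  then have "y \<noteq> 0" by auto
  moreover from this have "1 / cnj y = y"
    using y \<open>y \<noteq> 0\<close> complex_norm_square[of y] by (simp add: field_simps)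
  ultimately show "cmod (poly (star n G) y) \<le> cmod (poly G y)"
    using poly_star[OF assms(1), of y] y by (simp add: norm_mult norm_power)
qed

text \<open>Since $|G^*| \le |G|$ on the closed disc and $G$ has no zeros there, neither has
$G - \overline{s}\,G^*$ when $|s| < 1$. The polynomial $sG - G^*$ is, up to sign, the
reciprocal of that one, so its zeros are the reflections $1/\overline{w}$ of zeros outside the
closed disc. The value at $0$ of the one is the conjugate, up to sign, of the coefficient of $x^n$ of
the other, hence the degree is $n$.\<close>

lemma zeros_of_star_combination:
  assumes G: "degree G \<le> n" "\<And>x. cmod x \<le> 1 \<Longrightarrow> poly G x \<noteq> 0" and s: "cmod s < 1"
  shows "degree (smult s G - star n G) = n"
    and "poly (smult s G - star n G) w = 0 \<Longrightarrow> w \<in> ball 0 1"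
proof -
  have strict: "cnj s * poly (star n G) x \<noteq> poly G x" if "cmod x \<le> 1" for x
  proof
    assume eq: "cnj s * poly (star n G) x = poly G x"
    have "cmod (poly G x) = cmod s * cmod (poly (star n G) x)"
      by (simp add: eq[symmetric] norm_mult)
    also have "\<dots> \<le> cmod s * cmod (poly G x)"
      by (intro mult_left_mono star_dominated_on_disc[OF G that]) auto
    finally have "cmod (poly G x) \<le> cmod s * cmod (poly G x)" .
    then show False using s G(2)[OF that] by auto
  qed
  have "coeff (smult s G - star n G) n = - cnj (poly G 0 - cnj s * poly (star n G) 0)"
    using G(1) by (simp add: coeff_star poly_0_coeff_0)
  moreover have "poly G 0 - cnj s * poly (star n G) 0 \<noteq> 0" using strict[of 0] by auto
  ultimately have "coeff (smult s G - star n G) n \<noteq> 0" by (metis complex_cnj_zero_iff neg_equal_0_iff_equal)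
  moreover have "degree (smult s G - star n G) \<le> n"
    using G(1) by (intro degree_diff_le degree_star) (auto intro: order.trans[OF degree_smult_le])
  ultimately show "degree (smult s G - star n G) = n" by (intro antisym le_degree)
  show "w \<in> ball 0 1" if "poly (smult s G - star n G) w = 0"
  proof (rule ccontr)
    assume "w \<notin> ball 0 1"
    then have "1 \<le> cmod w" by simp
    then have w: "w \<noteq> 0" "cmod (1 / cnj w) \<le> 1" by (auto simp: norm_divide divide_le_eq)
    have "poly G w = w ^ n * cnj (poly (star n G) (1 / cnj w))"
      using poly_star[OF degree_star[OF G(1)] w(1)] by (simp add: star_star G(1))
    then have "w ^ n * cnj (cnj s * poly (star n G) (1 / cnj w) - poly G (1 / cnj w)) = 0"
      using that poly_star[OF G(1) w(1)] by (simp add: algebra_simps)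
    then have "cnj s * poly (star n G) (1 / cnj w) - poly G (1 / cnj w) = 0"
      using w(1) by (simp only: mult_eq_0_iff power_eq_0_iff complex_cnj_zero_iff) simp
    then show False using strict[OF w(2)] by simp
  qed
qed

section \<open>The estimate for self-inversive polynomials\<close>

text \<open>If $|N[G](z)| > |N[G^*](z)|$, then with the quotient $s = N[G^*](z)/N[G](z)$ the polynomial
$sG - G^*$ would contradict that $N[sG - G^*]$ does not vanish at $z$.\<close>

lemma N_op_le_N_op_star:
  assumes "m \<le> n" "n \<ge> 1"
    and "\<And>z. poly (phi n m lam) z = 0 \<Longrightarrow> cmod z \<le> cmod (z - of_nat n / 2)"
    and G: "degree G \<le> n" "\<And>x. cmod x \<le> 1 \<Longrightarrow> poly G x \<noteq> 0"
    and z: "1 \<le> cmod z"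
  shows "poly (N_op n m lam (star n G)) z \<noteq> 0"
    and "cmod (poly (N_op n m lam G) z) \<le> cmod (poly (N_op n m lam (star n G)) z)"
proof -
  let ?A = "poly (N_op n m lam G) z" and ?B = "poly (N_op n m lam (star n G)) z"
  have ne: "s * ?A \<noteq> ?B" if "cmod s < 1" for s
    using N_op_nonzero_outside_disc[OF assms(1-3) zeros_of_star_combination[OF G that] z]
    by (simp add: poly_N_op_diff poly_N_op_smult)
  show "?B \<noteq> 0" using ne[of 0] by auto
  show "cmod ?A \<le> cmod ?B"
  proof (rule ccontr)
    assume less: "\<not> cmod ?A \<le> cmod ?B"
    then have "?A \<noteq> 0" by auto
    then show False using ne[of "?B / ?A"] less by (simp add: norm_divide)
  qed
qed

text \<open>For $|s| > M$ the polynomial $G = P - s$ has no zeros in the closed disc, and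
$G^* = P - \overline{s} z^n$ because $P^* = P$. Comparing $N[G]$ and $N[G^*]$ bounds
$|A| - |s|\,|\lambda_0|$ by $|A - \overline{s} B|$, where $A = N[P](z)$ and $B = N[\psi_n](z)$. The
argument of $s$ is still free, and with $\overline{s} B$ on the ray through $A$ the right hand side is
$|s|\,|B| - |A|$, so that $2|A| \le |s|(|B| + |\lambda_0|)$. The modulus of $s$ can be taken arbitrarily
close to $M$.\<close>

lemma self_inversive_N_op_bound:
  assumes "m \<le> n" "n \<ge> 1"
    and "\<And>z. poly (phi n m lam) z = 0 \<Longrightarrow> cmod z \<le> cmod (z - of_nat n / 2)"
    and P: "self_inversive n P" and z: "1 \<le> cmod z"
  shows "cmod (poly (N_op n m lam P) z) \<le>
     1 / 2 * (cmod (poly (N_op n m lam (monom 1 n)) z) + cmod (lam 0)) * max_unit_circle P"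
proof -
  define M where "M = max_unit_circle P"
  define A where "A = poly (N_op n m lam P) z"
  define B where "B = poly (N_op n m lam (monom 1 n)) z"
  have M: "cmod (poly P w) \<le> M" if "cmod w = 1" for w
    using max_unit_circle_attained[of P] that by (auto simp: M_def)
  have M0: "0 \<le> M" using M[of 1] by (meson norm_ge_zero norm_one order.trans)
  have deg: "degree P \<le> n" and star: "star n P = P"
    using P by (auto simp: self_inversive_def polys_upto_def)
  have key: "A \<noteq> cnj s * B \<and> cmod (A - s * lam 0) \<le> cmod (A - cnj s * B)" if s: "M < cmod s" for s
  proof -
    define G where "G = P - smult s 1"
    have dG: "degree G \<le> n" unfolding G_def using deg by (intro degree_diff_le) auto
    have G: "poly G x \<noteq> 0" if x: "cmod x \<le> 1" for x
    proof -
      \<comment> \<open>the dominating constant must not vanish and must stay below cmod s, while M can be 0\<close>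
      define K where "K = (M + cmod s) / 2"
      have K: "M \<le> K" "0 < K" "K < cmod s" using s M0 by (auto simp: K_def)
      have "cmod (poly P x) \<le> cmod (poly [:of_real K:] x)"
      proof (rule polynomial_domination_on_disc[OF _ _ x])
        show "cmod (poly P y) \<le> cmod (poly [:of_real K:] y)" if "cmod y = 1" for y
          using M[OF that] K by simp
      qed (use K in simp)
      then have "cmod (poly P x) < cmod s" using K by simp
      then show ?thesis by (auto simp: G_def)
    qed
    have sG: "star n G = P - smult (cnj s) (monom 1 n)"
    proof (rule poly_eqI)
      fix k
      show "coeff (star n G) k = coeff (P - smult (cnj s) (monom 1 n)) k"
      proof (cases "k \<le> n")
        case True
        have "cnj (coeff P (n - k)) = coeff P k"
          using coeff_star[OF deg, of k] star True by simp
        then show ?thesis using coeff_star[OF dG, of k] True by (auto simp: G_def coeff_pCons split: nat.split)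
      qed (use deg in \<open>simp add: coeff_star[OF dG] coeff_eq_0\<close>)
    qed
    have "poly (N_op n m lam G) z = A - s * lam 0"
      by (simp only: G_def poly_N_op_diff poly_N_op_smult poly_N_op_1 A_def)
    moreover have "poly (N_op n m lam (star n G)) z = A - cnj s * B"
      by (simp only: sG poly_N_op_diff poly_N_op_smult A_def B_def)
    ultimately show ?thesis
      using N_op_le_N_op_star[OF assms(1,2) _ dG G z, of lam] assms(3) by auto
  qed
  have B: "B \<noteq> 0"
    unfolding B_def using assms(2)
    by (intro N_op_nonzero_outside_disc[OF assms(1-3) _ _ z]) (auto simp: degree_monom_eq poly_monom)
  \<comment> \<open>otherwise the first part of key fails for the s with A = cnj s * B\<close>
  have AB: "cmod A \<le> M * cmod B"
  proof (rule ccontr)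
    assume "\<not> cmod A \<le> M * cmod B"
    then have "M < cmod (cnj (A / B))" using B by (simp add: norm_divide field_simps)
    then show False using key[of "cnj (A / B)"] B by simp
  qed
  define C where "C = cmod B + cmod (lam 0)"
  have C: "C > 0" using B by (simp add: C_def add_pos_nonneg)
  have "2 * cmod A / C \<le> K" if K: "M < K" for K
  proof (cases "A = 0")
    case False
    have K0: "K > 0" using K M0 by simp
    \<comment> \<open>s has modulus K and makes cnj s * B the positive multiple q * A of A\<close>
    define q where "q = K * cmod B / cmod A"
    define s where "s = cnj (of_real q * A / B)"
    have cs: "cmod s = K" using False B K0 by (simp add: s_def q_def norm_divide norm_mult)
    have "A - cnj s * B = of_real (1 - q) * A" using B by (simp add: s_def algebra_simps)
    then have "cmod (A - cnj s * B) = \<bar>1 - q\<bar> * cmod A" by (simp only: norm_mult norm_of_real)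
    moreover have "cmod A \<le> K * cmod B"
      using AB K mult_right_mono[of M K "cmod B"] by simp
    then have "q \<ge> 1" using False by (simp add: q_def field_simps)
    ultimately have "cmod (A - cnj s * B) = K * cmod B - cmod A"
      using False by (simp add: q_def field_simps)
    moreover have "cmod A - K * cmod (lam 0) \<le> cmod (A - s * lam 0)"
      using norm_triangle_ineq2[of A "s * lam 0"] cs by (simp add: norm_mult)
    ultimately have "2 * cmod A \<le> K * C" using key[of s] cs K by (simp add: C_def algebra_simps)
    then show ?thesis using C by (simp add: field_simps)
  qed (use K M0 in simp)
  then have "2 * cmod A / C \<le> M" by (rule dense_ge)
  then show ?thesis using C by (simp add: field_simps A_def B_def C_def M_def)
qed

lemma max_unit_circle_monom_plus_1: "n \<ge> 1 \<Longrightarrow> max_unit_circle (monom 1 n + 1) = 2"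
proof -
  obtain z where z: "cmod z = 1" "max_unit_circle (monom 1 n + 1) = cmod (poly (monom 1 n + 1) z)"
     "\<forall>w. cmod w = 1 \<longrightarrow> cmod (poly (monom 1 n + 1) w) \<le> max_unit_circle (monom 1 n + 1)"
    using max_unit_circle_attained by blast
  have "2 \<le> max_unit_circle (monom 1 n + 1)" using z(3)[rule_format, of 1] by (simp add: poly_monom)
  moreover have "cmod (z ^ n + 1) \<le> 2"
    using norm_triangle_ineq[of "z ^ n" 1] z(1) by (simp add: norm_power)
  ultimately show ?thesis using z(2) by (simp add: poly_monom)
qed

text \<open>On the unit circle $N[\psi_n](z) = z^n \phi(n/2)$ and $N[1] = \lambda_0$. The triangle inequality for
their sum is an equality when $z^n$ rotates $\phi(n/2)$ into the direction of $\lambda_0$, which some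
$z$ on the circle does.\<close>

lemma N_op_equality_attained:
  assumes "m \<le> n" "n \<ge> 1"
  obtains z where "cmod z = 1"
    "cmod (poly (N_op n m lam (monom 1 n + 1)) z) =
       cmod (poly (N_op n m lam (monom 1 n)) z) + cmod (lam 0)"
proof -
  define v where "v = poly (phi n m lam) (of_nat n / 2)"
  have N: "poly (N_op n m lam (monom 1 n)) z = z ^ n * v" if "cmod z = 1" for z
  proof -
    have "z \<noteq> 0" using that by auto
    moreover have "monom 1 n = [:- (0::complex), 1:] ^ n" by (simp add: monom_altdef)
    ultimately show ?thesis using N_op_linear_power[OF assms(1), of z 0 lam] by (simp add: v_def)
  qed
  define \<theta> where "\<theta> = (Arg (lam 0) - Arg v) / n"
  define z where "z = cis \<theta>"
  have "real n * \<theta> = Arg (lam 0) - Arg v" using assms(2) by (simp add: \<theta>_def)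
  then have "z ^ n = cis (Arg (lam 0) - Arg v)" by (simp only: z_def Complex.DeMoivre)
  then have rot: "cis (Arg v) * z ^ n = cis (Arg (lam 0))" by (simp add: cis_mult)
  have polar: "of_real (cmod u) * cis (Arg u) = u" for u
    using rcis_cmod_Arg[of u] by (simp only: rcis_def)
  have "z ^ n * v = of_real (cmod v) * cis (Arg v) * z ^ n" by (simp only: polar) (rule mult.commute)
  also have "\<dots> = of_real (cmod v) * cis (Arg (lam 0))" by (simp only: mult.assoc rot)
  finally have "z ^ n * v + lam 0 = of_real (cmod v + cmod (lam 0)) * cis (Arg (lam 0))"
    by (simp only: of_real_add distrib_right polar)
  then have "cmod (z ^ n * v + lam 0) = cmod v + cmod (lam 0)"
    by (simp only: norm_mult norm_cis norm_of_real) simp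
  moreover have z: "cmod z = 1" by (simp add: z_def)
  ultimately show ?thesis
    using that[OF z] N[OF z] by (simp add: poly_N_op_add poly_N_op_1 norm_mult norm_power)
qed

theorem theorem1p4:
  fixes m n :: nat and lam :: "nat \<Rightarrow> complex"
  assumes "m \<le> n" and "n \<ge> 1"
    and "\<And>z. poly (phi n m lam) z = 0 \<Longrightarrow> cmod z \<le> cmod (z - of_nat n / 2)"
  shows "(\<forall>P z. self_inversive n P \<longrightarrow> cmod z \<ge> 1 \<longrightarrow>
            cmod (poly (N_op n m lam P) z)
              \<le> 1 / 2 * (cmod (poly (N_op n m lam (monom 1 n)) z) + cmod (lam 0)) * max_unit_circle P)
       \<and> (\<exists>z. cmod z \<ge> 1 \<and>
            cmod (poly (N_op n m lam (monom 1 n + 1)) z)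
              = 1 / 2 * (cmod (poly (N_op n m lam (monom 1 n)) z) + cmod (lam 0))
                  * max_unit_circle (monom 1 n + 1))"
proof (intro conjI allI impI)
  fix P z
  assume "self_inversive n P" "cmod z \<ge> 1"
  then show "cmod (poly (N_op n m lam P) z)
      \<le> 1 / 2 * (cmod (poly (N_op n m lam (monom 1 n)) z) + cmod (lam 0)) * max_unit_circle P"
    using assms by (intro self_inversive_N_op_bound)
next
  obtain z where z: "cmod z = 1" "cmod (poly (N_op n m lam (monom 1 n + 1)) z) =
      cmod (poly (N_op n m lam (monom 1 n)) z) + cmod (lam 0)"
    using N_op_equality_attained[OF assms(1,2)] by blast
  then show "\<exists>z. cmod z \<ge> 1 \<and>
      cmod (poly (N_op n m lam (monom 1 n + 1)) z)
        = 1 / 2 * (cmod (poly (N_op n m lam (monom 1 n)) z) + cmod (lam 0))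
            * max_unit_circle (monom 1 n + 1)"
    by (intro exI[of _ z]) (simp add: max_unit_circle_monom_plus_1[OF assms(2)])
qed

end
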